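(* Let $M$ be a monoid, let $\sigma: M\to M$ be an involutive automorphism and let $\tau: M\to M$ be an involutive anti-automorphism. The abelian solutions $f: M\to\mathbb{C}$ of the functional equation $$f(x\sigma(y))+f(\tau(y)x)=2f(x)f(y)\quad\text{for all } x,y\in M$$ are exactly the functions of the form $$f=\frac{\chi+\chi\circ\sigma\circ\tau}{2},$$ where $\chi: M\to\mathbb{C}$ is a multiplicative function such that: (i) $\chi\circ\sigma\circ\tau=\chi\circ\tau\circ\sigma$, and (ii) $\chi$ is $\sigma$-even and/or $\tau$-even (i.e. $\chi\circ\sigma=\chi$ or $\chi\circ\tau=\chi$, possibly both).
   Context: $\sigma$ being an involutive automorphism means $\sigma(xy)=\sigma(x)\sigma(y)$ and $\sigma(\sigma(x))=x$ for all $x,y\in M$; $\tau$ being an involutive anti-automorphism means $\tau(xy)=\tau(y)\tau(x)$ and $\tau(\tau(x))=x$ for all $x,y\in M$. A function $\chi: M\to\mathbb{C}$ is multiplicative if $\chi(xy)=\chi(x)\chi(y)$ for all $x,y\in M$ (the zero function is allowed). A function $f: M\to\mathbb{C}$ is abelian if $f(x_1x_2\cdots x_n)=f(x_{\epsilon(1)}x_{\epsilon(2)}\cdots x_{\epsilon(n)})$ for every $n\ge 2$, all $x_1,\dots,x_n\in M$ and every permutation $\epsilon$ of $\{1,\dots,n\}$. *)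

theory Defs
  imports Complex_Main "HOL-Combinatorics.Permutations"
begin

definition involutive_automorphism :: "('a::monoid_mult \<Rightarrow> 'a) \<Rightarrow> bool" where
  "involutive_automorphism \<sigma> \<longleftrightarrow>
     (\<forall>x y. \<sigma> (x * y) = \<sigma> x * \<sigma> y) \<and> (\<forall>x. \<sigma> (\<sigma> x) = x)"

definition involutive_anti_automorphism :: "('a::monoid_mult \<Rightarrow> 'a) \<Rightarrow> bool" where
  "involutive_anti_automorphism \<tau> \<longleftrightarrow>
     (\<forall>x y. \<tau> (x * y) = \<tau> y * \<tau> x) \<and> (\<forall>x. \<tau> (\<tau> x) = x)"

text \<open>No normalisation at \<open>1\<close>: the zero function counts as multiplicative.\<close>

definition multiplicative_fun :: "('a::monoid_mult \<Rightarrow> complex) \<Rightarrow> bool" where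
  "multiplicative_fun \<chi> \<longleftrightarrow> (\<forall>x y. \<chi> (x * y) = \<chi> x * \<chi> y)"

text \<open>The points \<open>x\<^sub>1, \<dots>, x\<^sub>n\<close> are the values of \<open>x\<close> on \<open>{1..n}\<close>; its values
  elsewhere are irrelevant. The product is ordered, hence \<open>prod_list\<close>.\<close>

definition abelian_fun :: "('a::monoid_mult \<Rightarrow> complex) \<Rightarrow> bool" where
  "abelian_fun f \<longleftrightarrow>
     (\<forall>n\<ge>2. \<forall>(x :: nat \<Rightarrow> 'a) \<epsilon>. \<epsilon> permutes {1..n} \<longrightarrow>
        f (prod_list (map x [1..<Suc n])) = f (prod_list (map (\<lambda>i. x (\<epsilon> i)) [1..<Suc n])))"

end

theory Submission
  imports Defs
begin

text \<open>
  Suppose \<open>f\<close> is a non-zero abelian solution. Then \<open>f 1 = 1\<close>, and \<open>x = 1\<close> in the equation says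
  that \<open>f\<close> is the average of \<open>f \<circ> \<sigma>\<close> and \<open>f \<circ> \<tau>\<close>. Consequently \<open>f\<close> is also the average of
  \<open>f \<circ> \<sigma> \<circ> \<tau>\<close> and \<open>f \<circ> \<tau> \<circ> \<sigma>\<close>, so it varies linearly along the orbits of \<open>\<sigma> \<circ> \<tau>\<close>. Evaluating
  at a square \<open>x * x\<close>, where the equation predicts a quadratic dependence, forces the slope to
  vanish: \<open>f\<close> is both \<open>\<sigma>\<close>-even and \<open>\<tau>\<close>-even (lemma \<open>abelian_solution_even\<close>).

  Put \<open>\<phi> = \<tau> \<circ> \<sigma>\<close>. Evenness turns the equation into d'Alembert's equation
  \<open>f (x * y) + f (x * \<phi> y) = 2 * f x * f y\<close> with \<open>f \<circ> \<phi> = f\<close>. As for the classical cosine equation,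
  the defect \<open>f (x * y) - f x * f y\<close> is a symmetric kernel of rank at most one whose sections are
  odd under \<open>\<phi>\<close> and satisfy the sine addition law; adding a normalised section to \<open>f\<close> yields a
  multiplicative \<open>\<chi>\<close> with \<open>f = (\<chi> + \<chi> \<circ> \<phi>) / 2\<close> (lemma \<open>dalembert_solution\<close>).

  The conditions on \<open>\<chi>\<close> then come from comparing decompositions: \<open>f \<circ> \<phi> = f\<close> gives
  \<open>\<chi> \<circ> \<phi> \<circ> \<phi> = \<chi>\<close>, that is, \<open>\<chi> \<circ> \<sigma> \<circ> \<tau> = \<chi> \<circ> \<tau> \<circ> \<sigma>\<close>, and \<open>f \<circ> \<sigma> = f\<close> together with the uniqueness of a
  representation as a sum of two multiplicative functions (lemma \<open>multiplicative_fun_pair_unique\<close>)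
  gives \<open>\<chi> \<circ> \<sigma> = \<chi>\<close> or \<open>\<chi> \<circ> \<sigma> = \<chi> \<circ> \<tau> \<circ> \<sigma>\<close>; the latter means \<open>\<chi> \<circ> \<tau> = \<chi>\<close>. The converse is a
  direct computation.
\<close>

section \<open>Abelian functions\<close>

text \<open>
  This one transposition suffices for every rearrangement used below: \<open>z = 1\<close> gives
  \<open>f (x * y) = f (y * x)\<close>, hence invariance under cyclic shifts, and products may be grouped.
\<close>

lemma abelian_fun_swap:
  assumes "abelian_fun f"
  shows "f (x * y * z) = f (y * x * z)"
proof -
  define v where "v = (\<lambda>i::nat. if i = 1 then x else if i = 2 then y else z)"
  have "transpose 1 2 permutes {1..3::nat}"
    by (intro permutes_swap_id) auto
  moreover have "[1..<Suc 3] = [1, 2, 3]"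
    by (simp add: upt_rec)
  ultimately have "f (prod_list (map v [1, 2, 3])) =
      f (prod_list (map (\<lambda>i. v (transpose 1 2 i)) [1, 2, 3]))"
    using assms[unfolded abelian_fun_def, rule_format, of 3 "transpose 1 2" v] by simp
  then show ?thesis
    by (simp add: v_def transpose_def mult.assoc)
qed

lemma abelian_fun_mean:
  assumes "abelian_fun g" "abelian_fun h"
  shows "abelian_fun (\<lambda>x. (g x + h x) / 2)"
  unfolding abelian_fun_def
proof (intro allI impI)
  fix n :: nat and x :: "nat \<Rightarrow> 'a" and \<epsilon>
  assume n: "n \<ge> 2" and \<epsilon>: "\<epsilon> permutes {1..n}"
  show "(g (prod_list (map x [1..<Suc n])) + h (prod_list (map x [1..<Suc n]))) / 2 =
      (g (prod_list (map (\<lambda>i. x (\<epsilon> i)) [1..<Suc n])) +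
       h (prod_list (map (\<lambda>i. x (\<epsilon> i)) [1..<Suc n]))) / 2"
    using assms[unfolded abelian_fun_def, rule_format, OF n \<epsilon>, of x] by (simp only:)
qed

text \<open>
  The factor \<open>\<chi> 1\<close> is there because \<open>\<chi>\<close> may vanish identically, in which case the
  empty product on the left is sent to \<open>0\<close>.
\<close>

lemma multiplicative_fun_prod_list:
  assumes "multiplicative_fun \<chi>"
  shows "\<chi> (prod_list xs) = \<chi> 1 * prod_list (map \<chi> xs)"
proof (induction xs)
  case (Cons a xs)
  have "\<chi> (a * prod_list xs) = \<chi> a * \<chi> (prod_list xs)"
    using assms by (simp add: multiplicative_fun_def)
  with Cons show ?case by (simp add: ac_simps)
qed simp

lemma multiplicative_fun_abelian:
  assumes "multiplicative_fun \<chi>"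
  shows "abelian_fun \<chi>"
  unfolding abelian_fun_def
proof (intro allI impI)
  fix n :: nat and x :: "nat \<Rightarrow> 'a" and \<epsilon>
  assume \<epsilon>: "\<epsilon> permutes {1..n}"
  have *: "\<chi> (prod_list (map y [1..<Suc n])) = \<chi> 1 * (\<Prod>i\<in>{1..n}. \<chi> (y i))" for y
    using multiplicative_fun_prod_list[OF assms, of "map y [1..<Suc n]"]
      prod.distinct_set_conv_list[of "[1..<Suc n]" "\<chi> \<circ> y"]
    by (simp add: atLeastLessThanSuc_atLeastAtMost comp_def del: upt_Suc)
  show "\<chi> (prod_list (map x [1..<Suc n])) = \<chi> (prod_list (map (\<lambda>i. x (\<epsilon> i)) [1..<Suc n]))"
    using prod.permute[OF \<epsilon>, of "\<lambda>i. \<chi> (x i)"] unfolding * by (simp add: comp_def)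
qed

section \<open>Sums of two multiplicative functions\<close>

text \<open>
  A two-term instance of the linear independence of characters. Comparing values at \<open>x\<close> and
  \<open>x * x\<close> shows that \<open>{a x, b x} = {c x, d x}\<close> for each \<open>x\<close>; the value at a product \<open>x * y\<close>
  prevents the matching from changing from one point to another.
\<close>

lemma multiplicative_fun_pair_unique:
  assumes "multiplicative_fun a" "multiplicative_fun b" "multiplicative_fun c" "multiplicative_fun d"
    and sum: "\<And>x. a x + b x = c x + d x"
  shows "a = c \<or> a = d"
proof (rule ccontr)
  have mult: "a (x * y) = a x * a y" "b (x * y) = b x * b y"
      "c (x * y) = c x * c y" "d (x * y) = d x * d y" for x y
    using assms unfolding multiplicative_fun_def by auto
  have split: "a x = c x \<and> b x = d x \<or> a x = d x \<and> b x = c x" for x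
  proof -
    have b: "b x = c x + d x - a x"
      using sum[of x] by (simp add: algebra_simps)
    have "a x * a x + b x * b x = c x * c x + d x * d x"
      using sum[of "x * x"] by (simp add: mult)
    then have "2 * ((a x - c x) * (a x - d x)) = 0"
      unfolding b by (simp add: algebra_simps)
    then show ?thesis
      using b by auto
  qed
  assume "\<not> (a = c \<or> a = d)"
  then obtain x y where "a x \<noteq> c x" "a y \<noteq> d y"
    by (metis ext)
  with split[of x] split[of y]
  have eqs: "a x = d x" "b x = c x" "a y = c y" "b y = d y" and ne: "d x \<noteq> c x" "c y \<noteq> d y"
    by auto
  have "d x * c y + c x * d y = c x * c y + d x * d y"
    using sum[of "x * y"] by (simp add: mult eqs)
  then have "(d x - c x) * (c y - d y) = 0"
    by (simp add: algebra_simps)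
  with ne show False by simp
qed

section \<open>D'Alembert's equation\<close>

text \<open>
  The kernel \<open>S x y = f (x * y) - f x * f y\<close> measures how far \<open>f\<close> is from being multiplicative;
  if \<open>f\<close> were the cosine, it would be \<open>- sin x * sin y\<close>. Expanding \<open>f (x * \<phi> y * \<phi> z)\<close> in two ways
  shows that \<open>S\<close> obeys the sine addition law in its first argument, and the symmetry of
  \<open>f (x * y * z * w)\<close> then shows that \<open>S\<close> has rank at most one. A square root \<open>s\<close> of a non-zero diagonal
  value \<open>S a a\<close> plays the part of \<open>\<i> * sin a\<close>, so that \<open>\<chi> x = f x + S x a / s\<close> is the analogue of
  \<open>exp (\<i> * x)\<close>.
\<close>

lemma dalembert_solution:
  fixes f :: "'a::monoid_mult \<Rightarrow> complex"
  assumes swap: "\<And>x y z. f (x * y * z) = f (y * x * z)"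
    and anti: "\<And>x y. \<phi> (x * y) = \<phi> y * \<phi> x"
    and inv: "\<And>x. f (\<phi> x) = f x"
    and eq: "\<And>x y. f (x * y) + f (x * \<phi> y) = 2 * f x * f y"
  shows "\<exists>\<chi>. multiplicative_fun \<chi> \<and> (\<forall>x. f x = (\<chi> x + \<chi> (\<phi> x)) / 2)"
proof -
  have comm: "f (x * y) = f (y * x)" for x y
    using swap[of x y 1] by simp
  have eq': "f (x * \<phi> y) = 2 * f x * f y - f (x * y)" for x y
    using eq[of x y] by (simp add: algebra_simps)
  define S where "S x y = f (x * y) - f x * f y" for x y
  have S_comm: "S x y = S y x" for x y
    by (simp add: S_def comm[of x] mult.commute)
  have sine: "S (x * y) z = f x * S y z + f y * S x z" for x y z
  proof -
    have "f (x * \<phi> y * \<phi> z) = 2 * f (x * \<phi> y) * f z - f (x * \<phi> y * z)"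
      by (rule eq')
    also have "f (x * \<phi> y * z) = f (x * z * \<phi> y)"
      using comm[of "x * \<phi> y" z] swap[of x z "\<phi> y"] by (simp add: mult.assoc)
    also have "\<dots> = 2 * f (x * z) * f y - f (x * z * y)"
      by (rule eq')
    also have "f (x * z * y) = f (x * y * z)"
      using comm[of "x * z" y] swap[of y x z] by (simp add: mult.assoc)
    finally have 1: "f (x * \<phi> y * \<phi> z) =
        2 * f (x * \<phi> y) * f z - (2 * f (x * z) * f y - f (x * y * z))" .
    have "f (x * \<phi> y * \<phi> z) = f (x * \<phi> (z * y))"
      by (simp add: anti mult.assoc)
    also have "\<dots> = 2 * f x * f (z * y) - f (x * (z * y))"
      by (rule eq')
    also have "f (x * (z * y)) = f (x * y * z)"
      using comm[of "x * z" y] swap[of y x z] by (simp add: mult.assoc)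
    finally have 2: "f (x * \<phi> y * \<phi> z) = 2 * f x * f (y * z) - f (x * y * z)"
      by (simp add: comm[of z])
    have "2 * (S (x * y) z - (f x * S y z + f y * S x z)) =
        (2 * (2 * f x * f y - f (x * y)) * f z - (2 * f (x * z) * f y - f (x * y * z))) -
        (2 * f x * f (y * z) - f (x * y * z))"
      by (simp add: S_def algebra_simps)
    also have "\<dots> = 0"
      using 1 2 by (simp add: eq'[of x y])
    finally show ?thesis by (simp only: mult_eq_0_iff right_minus_eq) simp
  qed
  have rank_one: "S x y * S z w = S z y * S x w" for x y z w
  proof -
    have reverse: "f (x * y * z * v) = f (z * y * x * v)" for v
      using swap[of x y "z * v"] swap[of "y * x" z v] by (simp add: mult.assoc)
    have "S (x * y * z) w = S (z * y * x) w"
      using reverse[of w] reverse[of 1] by (simp add: S_def)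
    then show ?thesis
      by (simp add: sine) (simp add: S_def comm[of z y] algebra_simps)
  qed
  have odd: "S (\<phi> x) a = - S x a" for x a
    using eq'[of a x] by (simp add: S_def inv comm[of _ a])
  show ?thesis
  proof (cases "\<exists>a. S a a \<noteq> 0")
    case True
    then obtain a where a: "S a a \<noteq> 0" by blast
    define s where "s = csqrt (S a a)"
    have ss: "s * s = S a a"
      using power2_csqrt[of "S a a"] by (simp add: s_def power2_eq_square)
    with a have "s \<noteq> 0" by auto
    define \<chi> where "\<chi> x = f x + S x a / s" for x
    have "\<chi> (x * y) = \<chi> x * \<chi> y" for x y
    proof -
      have "S x a * S y a = S x y * (s * s)"
        using rank_one[of x a a y] S_comm[of a y] ss by (simp add: ac_simps)
      then have "S x a / s * (S y a / s) = S x y"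
        using \<open>s \<noteq> 0\<close> by (simp add: field_simps)
      then have "\<chi> x * \<chi> y = f x * f y + S x y + (f x * S y a + f y * S x a) / s"
        by (simp add: \<chi>_def algebra_simps add_divide_distrib)
      then show ?thesis
        by (simp add: \<chi>_def sine) (simp add: S_def)
    qed
    moreover have "f x = (\<chi> x + \<chi> (\<phi> x)) / 2" for x
      by (simp add: \<chi>_def odd inv)
    ultimately show ?thesis
      unfolding multiplicative_fun_def by blast
  next
    \<comment> \<open>A kernel of rank at most one with zero diagonal vanishes, so \<open>f\<close> itself is multiplicative.\<close>
    case False
    have "S x y = 0" for x y
      using rank_one[of x y y x] S_comm[of y x] False by simp
    then have "multiplicative_fun f"
      by (simp add: multiplicative_fun_def S_def)
    moreover have "f x = (f x + f (\<phi> x)) / 2" for x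
      by (simp add: inv)
    ultimately show ?thesis by blast
  qed
qed

section \<open>Evenness of the solutions\<close>

text \<open>
  Write \<open>\<delta> = f (\<sigma> (\<tau> x)) - f x\<close>. The equation computes the values of \<open>f\<close> at the squares of
  \<open>\<sigma> (\<tau> x)\<close> and of \<open>\<tau> (\<sigma> x)\<close> from \<open>f (x * x)\<close>. These squares are also the images of \<open>x * x\<close>, so
  their average has to be \<open>f (x * x)\<close>, whereas the computation yields an additional term
  proportional to \<open>\<delta>\<^sup>2\<close>.
\<close>

lemma abelian_solution_even:
  fixes f :: "'a::monoid_mult \<Rightarrow> complex"
  assumes \<sigma>: "involutive_automorphism \<sigma>" and \<tau>: "involutive_anti_automorphism \<tau>"
    and comm: "\<And>x y. f (x * y) = f (y * x)" and "f 1 = 1"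
    and eq: "\<And>x y. f (x * \<sigma> y) + f (\<tau> y * x) = 2 * f x * f y"
  shows "f (\<sigma> x) = f x" "f (\<tau> x) = f x"
proof -
  have \<sigma>_simps: "\<sigma> (x * y) = \<sigma> x * \<sigma> y" "\<sigma> (\<sigma> x) = x" for x y
    using \<sigma> by (auto simp: involutive_automorphism_def)
  have \<tau>_simps: "\<tau> (x * y) = \<tau> y * \<tau> x" "\<tau> (\<tau> x) = x" for x y
    using \<tau> by (auto simp: involutive_anti_automorphism_def)
  have mean: "f (\<sigma> z) + f (\<tau> z) = 2 * f z" for z
    using eq[of 1 z] \<open>f 1 = 1\<close> by simp
  have st: "f (\<sigma> (\<tau> z)) = 2 * f (\<tau> z) - f z" for z
    using mean[of "\<tau> z"] by (simp add: \<tau>_simps algebra_simps)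
  have ts: "f (\<tau> (\<sigma> z)) = 2 * f (\<sigma> z) - f z" for z
    using mean[of "\<sigma> z"] by (simp add: \<sigma>_simps algebra_simps)
  have mult_st: "f (z * \<sigma> (\<tau> x)) = 2 * f z * f (\<tau> x) - f (z * x)" for z
    using eq[of z "\<tau> x"] by (simp add: \<tau>_simps comm[of x] algebra_simps)
  have mult_ts: "f (z * \<tau> (\<sigma> x)) = 2 * f z * f (\<sigma> x) - f (z * x)" for z
    using eq[of z "\<sigma> x"] by (simp add: \<sigma>_simps comm[of _ z] algebra_simps)
  have 1: "f (\<sigma> (\<tau> (x * x))) = f (x * x) + 2 * (f (\<sigma> (\<tau> x)) - f x) * f (\<tau> x)"
    using mult_st[of "\<sigma> (\<tau> x)"] mult_st[of x]
    by (simp add: \<sigma>_simps \<tau>_simps comm[of "\<sigma> (\<tau> x)" x] algebra_simps)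
  have 2: "f (\<tau> (\<sigma> (x * x))) = f (x * x) + 2 * (f (\<tau> (\<sigma> x)) - f x) * f (\<sigma> x)"
    using mult_ts[of "\<tau> (\<sigma> x)"] mult_ts[of x]
    by (simp add: \<sigma>_simps \<tau>_simps comm[of "\<tau> (\<sigma> x)" x] algebra_simps)
  have \<sigma>x: "f (\<sigma> x) = 2 * f x - f (\<tau> x)"
    using mean[of x] by (simp add: algebra_simps)
  have "f (\<sigma> (\<tau> (x * x))) + f (\<tau> (\<sigma> (x * x))) =
      2 * (f (\<sigma> (x * x)) + f (\<tau> (x * x))) - 2 * f (x * x)"
    unfolding st ts by (simp add: algebra_simps)
  also have "\<dots> = 2 * f (x * x)"
    by (simp add: mean)
  finally have sum: "f (\<sigma> (\<tau> (x * x))) + f (\<tau> (\<sigma> (x * x))) = 2 * f (x * x)" .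
  have "8 * ((f (\<tau> x) - f x) * (f (\<tau> x) - f x)) =
      f (\<sigma> (\<tau> (x * x))) + f (\<tau> (\<sigma> (x * x))) - 2 * f (x * x)"
    unfolding 1 2 unfolding st ts \<sigma>x by (simp add: algebra_simps)
  also have "\<dots> = 0"
    unfolding sum by simp
  finally show "f (\<tau> x) = f x" by simp
  with \<sigma>x show "f (\<sigma> x) = f x" by simp
qed

section \<open>The abelian solutions\<close>

theorem theorem3p4:
  fixes \<sigma> \<tau> :: "'a::monoid_mult \<Rightarrow> 'a" and f :: "'a \<Rightarrow> complex"
  assumes "involutive_automorphism \<sigma>"
    and "involutive_anti_automorphism \<tau>"
  shows "(abelian_fun f \<and> (\<forall>x y. f (x * \<sigma> y) + f (\<tau> y * x) = 2 * f x * f y)) \<longleftrightarrow>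
    (\<exists>\<chi> :: 'a \<Rightarrow> complex. multiplicative_fun \<chi> \<and>
       \<chi> \<circ> \<sigma> \<circ> \<tau> = \<chi> \<circ> \<tau> \<circ> \<sigma> \<and>
       (\<chi> \<circ> \<sigma> = \<chi> \<or> \<chi> \<circ> \<tau> = \<chi>) \<and>
       f = (\<lambda>x. (\<chi> x + (\<chi> \<circ> \<sigma> \<circ> \<tau>) x) / 2))"
    (is "?solution \<longleftrightarrow> ?form")
proof
  have \<sigma>: "\<sigma> (x * y) = \<sigma> x * \<sigma> y" "\<sigma> (\<sigma> x) = x" for x y
    using assms by (auto simp: involutive_automorphism_def)
  have \<tau>: "\<tau> (x * y) = \<tau> y * \<tau> x" "\<tau> (\<tau> x) = x" for x y
    using assms by (auto simp: involutive_anti_automorphism_def)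
  {
    assume ?solution
    then have "abelian_fun f" and eq: "f (x * \<sigma> y) + f (\<tau> y * x) = 2 * f x * f y" for x y
      by auto
    have swap: "f (x * y * z) = f (y * x * z)" for x y z
      using \<open>abelian_fun f\<close> by (rule abelian_fun_swap)
    have comm: "f (x * y) = f (y * x)" for x y
      using swap[of x y 1] by simp
    show ?form
    proof (cases "f = (\<lambda>_. 0)")
      case True
      then show ?thesis
        by (intro exI[of _ "\<lambda>_. 0"]) (auto simp: multiplicative_fun_def)
    next
      case False
      then obtain z where z: "f z \<noteq> 0" by auto
      have "\<sigma> 1 = 1"
        using \<sigma>(1)[of 1 "\<sigma> 1"] by (simp add: \<sigma>(2))
      moreover have "\<tau> 1 = 1"
        using \<tau>(1)[of 1 "\<tau> 1"] by (simp add: \<tau>(2))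
      ultimately have "f 1 = 1"
        using eq[of z 1] z by simp
      note even = abelian_solution_even[OF assms comm this eq]
      define \<phi> where "\<phi> x = \<tau> (\<sigma> x)" for x
      have "\<exists>\<chi>. multiplicative_fun \<chi> \<and> (\<forall>x. f x = (\<chi> x + \<chi> (\<phi> x)) / 2)"
      proof (rule dalembert_solution)
        show "f (x * y) + f (x * \<phi> y) = 2 * f x * f y" for x y
          using eq[of x "\<sigma> y"] by (simp add: \<sigma> \<phi>_def even comm[of x "\<tau> (\<sigma> y)"])
      qed (simp_all add: swap \<phi>_def \<sigma> \<tau> even)
      then obtain \<chi> where \<chi>: "multiplicative_fun \<chi>" and f: "\<And>x. f x = (\<chi> x + \<chi> (\<phi> x)) / 2"
        by blast
      have "f (\<phi> x) = f x" for x
        by (simp add: \<phi>_def even)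
      then have \<phi>\<phi>: "\<chi> (\<phi> (\<phi> x)) = \<chi> x" for x
        unfolding f by simp
      have comm_st: "\<chi> (\<sigma> (\<tau> x)) = \<chi> (\<tau> (\<sigma> x))" for x
        using \<phi>\<phi>[of "\<sigma> (\<tau> x)"] by (simp add: \<phi>_def \<sigma> \<tau>)
      have "(\<lambda>x. \<chi> (\<sigma> x)) = \<chi> \<or> (\<lambda>x. \<chi> (\<sigma> x)) = (\<lambda>x. \<chi> (\<phi> x))"
      proof (rule multiplicative_fun_pair_unique[of _ "\<lambda>x. \<chi> (\<phi> (\<sigma> x))"])
        show "\<chi> (\<sigma> x) + \<chi> (\<phi> (\<sigma> x)) = \<chi> x + \<chi> (\<phi> x)" for x
          using even(1)[of x] unfolding f by (simp only: divide_cancel_right) simp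
      qed (use \<chi> in \<open>simp_all add: multiplicative_fun_def \<phi>_def \<sigma> \<tau> mult.commute\<close>)
      moreover have "\<chi> \<circ> \<tau> = \<chi>" if "(\<lambda>x. \<chi> (\<sigma> x)) = (\<lambda>x. \<chi> (\<phi> x))"
      proof
        show "(\<chi> \<circ> \<tau>) x = \<chi> x" for x
          using fun_cong[OF that, of "\<sigma> x"] by (simp add: \<phi>_def \<sigma>)
      qed
      ultimately have "\<chi> \<circ> \<sigma> = \<chi> \<or> \<chi> \<circ> \<tau> = \<chi>"
        by (auto simp: comp_def)
      moreover have "\<chi> \<circ> \<sigma> \<circ> \<tau> = \<chi> \<circ> \<tau> \<circ> \<sigma>"
        by (simp add: fun_eq_iff comm_st)
      moreover have "f = (\<lambda>x. (\<chi> x + (\<chi> \<circ> \<sigma> \<circ> \<tau>) x) / 2)"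
        by (rule ext) (simp add: f \<phi>_def comm_st)
      ultimately show ?thesis
        using \<chi> by blast
    qed
  }
  {
    assume ?form
    then obtain \<chi> where \<chi>: "multiplicative_fun \<chi>" and "\<chi> \<circ> \<sigma> \<circ> \<tau> = \<chi> \<circ> \<tau> \<circ> \<sigma>"
      and even: "\<chi> \<circ> \<sigma> = \<chi> \<or> \<chi> \<circ> \<tau> = \<chi>"
      and f: "f = (\<lambda>x. (\<chi> x + (\<chi> \<circ> \<sigma> \<circ> \<tau>) x) / 2)"
      by blast
    then have st: "\<chi> (\<sigma> (\<tau> x)) = \<chi> (\<tau> (\<sigma> x))" for x
      by (simp add: fun_eq_iff)
    have mult: "\<chi> (x * y) = \<chi> x * \<chi> y" for x y
      using \<chi> by (simp add: multiplicative_fun_def)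
    have tst: "\<chi> (\<tau> (\<sigma> (\<tau> y))) = \<chi> (\<sigma> y)" for y
      using st[of "\<tau> y"] by (simp add: \<tau>)
    have "multiplicative_fun (\<chi> \<circ> \<sigma> \<circ> \<tau>)"
      by (simp add: multiplicative_fun_def mult \<sigma> \<tau> mult.commute)
    with \<chi> have "abelian_fun \<chi>" "abelian_fun (\<chi> \<circ> \<sigma> \<circ> \<tau>)"
      by (simp_all add: multiplicative_fun_abelian)
    then have "abelian_fun f"
      unfolding f by (rule abelian_fun_mean)
    \<comment> \<open>Either parity of \<open>\<chi>\<close> makes \<open>{\<chi> \<circ> \<sigma>, \<chi> \<circ> \<tau>}\<close> equal to \<open>{\<chi>, \<chi> \<circ> \<sigma> \<circ> \<tau>}\<close>.\<close>
    have sum: "\<chi> (\<sigma> y) + \<chi> (\<tau> y) = 2 * f y" for y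
      using even
    proof
      assume "\<chi> \<circ> \<sigma> = \<chi>"
      then have "\<chi> (\<sigma> z) = \<chi> z" for z by (simp add: fun_eq_iff)
      then show ?thesis by (simp add: f)
    next
      assume "\<chi> \<circ> \<tau> = \<chi>"
      then have "\<chi> (\<tau> z) = \<chi> z" for z by (simp add: fun_eq_iff)
      then show ?thesis by (simp add: f st)
    qed
    have "f (x * \<sigma> y) + f (\<tau> y * x) = 2 * f x * f y" for x y
    proof -
      have "f (x * \<sigma> y) + f (\<tau> y * x) =
          (\<chi> x + \<chi> (\<sigma> (\<tau> x))) * (\<chi> (\<sigma> y) + \<chi> (\<tau> y)) / 2"
        by (simp add: f mult st tst \<sigma> \<tau> field_simps)
      also have "\<dots> = (2 * f x) * (2 * f y) / 2"
        unfolding sum by (simp add: f)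
      finally show ?thesis by simp
    qed
    with \<open>abelian_fun f\<close> show ?solution by blast
  }
qed

end
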